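(* For $a\in(1/15,\infty)$ and $n\in\mathbb{N}$ let $$l_n(a)=H_n-\frac{1}{90a^2+2}\ln\left(n^2+n+\frac{3a+1}{3}\right)-\frac{45a^2}{90a^2+2}\ln\left(n^2+n+\frac{15a-1}{45a}\right).$$ Then for all $n\in\mathbb{N}$, $$l_n(a_1)<\gamma\le l_n(a_0),$$ where $a_1=\frac{40+3\sqrt{205}}{105}$ is the best constant (i.e. it cannot be replaced by any smaller number in the left-hand inequality for all $n$), and $a_0\approx 0.512967071402$. Also, for every $n\in\mathbb{N}$, $l_n(a)$ is strictly decreasing in $a$ on $(1/15,\infty)$.
   Context: $\mathbb{N}=\{1,2,3,\ldots\}$, $H_n=\sum_{k=1}^n \frac1k$ is the $n$-th harmonic number, $\gamma=0.5772\ldots$ is the Euler–Mascheroni constant. The number $a_0$ is the unique root on $(1/15,\infty)$ of the equation (in $a$) $$\frac{1}{90a^2+2}\ln\frac{3a+1}{3}+\frac{45a^2}{90a^2+2}\ln\frac{15a-1}{45a}=\psi(1)=-\gamma,$$ where $\psi=\Gamma'/\Gamma$ is the digamma function. *)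

theory Defs
  imports "HOL-Analysis.Analysis"
begin

definition l :: "nat \<Rightarrow> real \<Rightarrow> real" where
  "l n a = harm n
     - 1 / (90 * a\<^sup>2 + 2) * ln ((real n)\<^sup>2 + real n + (3 * a + 1) / 3)
     - 45 * a\<^sup>2 / (90 * a\<^sup>2 + 2) * ln ((real n)\<^sup>2 + real n + (15 * a - 1) / (45 * a))"

(* The domain condition is part of the predicate because ln is total in HOL; for a > 1/15
   all arguments of ln here and in l are positive. *)
definition is_root :: "real \<Rightarrow> bool" where
  "is_root a \<longleftrightarrow> a > 1 / 15 \<and>
     1 / (90 * a\<^sup>2 + 2) * ln ((3 * a + 1) / 3)
       + 45 * a\<^sup>2 / (90 * a\<^sup>2 + 2) * ln ((15 * a - 1) / (45 * a)) = Digamma 1"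

definition a\<^sub>0 :: real where
  "a\<^sub>0 = (THE a. is_root a)"

definition a\<^sub>1 :: real where
  "a\<^sub>1 = (40 + 3 * sqrt 205) / 105"

end

theory Submission
  imports Defs "HOL-Real_Asymp.Real_Asymp"
begin

text \<open>
  Write \<open>l n a = harm n - \<phi> n\<close>, where \<open>\<phi> x\<close> is the weighted mean of the logarithms of
  \<open>x\<^sup>2 + x + u\<close> and \<open>x\<^sup>2 + x + v\<close> with the shifts \<open>u = a + 1/3\<close> and \<open>v = 1/3 - 1/(45 a)\<close>. The
  weights add up to one half, so \<open>\<phi> x - ln x\<close> tends to \<open>0\<close> and \<open>l n a\<close> tends to \<open>\<gamma>\<close>. To compare
  \<open>l n a\<close> with its limit it is enough to know the sign of the increments
  \<open>1/(x + 1) - \<phi> (x + 1) + \<phi> x\<close>; these tend to \<open>0\<close>, so a derivative of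
  constant sign forces the opposite sign on them (\<open>euler_mascheroni_less_harm_minus\<close>,
  \<open>harm_minus_less_euler_mascheroni\<close>).

  That derivative is a rational function of \<open>z = (x + 1)\<^sup>2\<close> with positive denominator. Its numerator
  has degree four for arbitrary shifts and weights, but the given ones are chosen so that the three
  highest coefficients vanish. What remains is \<open>c z - u\<^sup>2 v\<^sup>2\<close>, with
  \<open>c = 16/135 - 7/45 (a - 1/(45 a))\<close> (\<open>log_mean_increment_derivative\<close>). The coefficient \<open>c\<close>
  decreases in \<open>a\<close> and \<open>a\<^sub>1\<close> is its positive zero. Hence \<open>l n a\<^sub>1 < \<gamma>\<close> for all \<open>n\<close>, whereas for \<open>a < a\<^sub>1\<close>
  the numerator is positive for large \<open>z\<close>, which gives \<open>l n a > \<gamma>\<close> for large \<open>n\<close>. So \<open>a\<^sub>1\<close> is the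
  best constant.

  The derivative of \<open>\<phi>\<close> with respect to \<open>a\<close> is, up to a positive factor, the error of the
  trapezoidal rule for the integral of \<open>1/t\<close> between \<open>x\<^sup>2 + x + v\<close> and \<open>x\<^sup>2 + x + u\<close>. It is positive
  since \<open>1/t\<close> is convex, so \<open>l n\<close> is strictly decreasing.

  Since \<open>harm 0 = 0\<close>, the equation defining \<open>a\<^sub>0\<close> says \<open>l 0 a = \<gamma>\<close>. Monotonicity of \<open>l 0\<close> makes the
  root unique, and a change of sign of \<open>l 0 - \<gamma>\<close> locates it. The interval claimed for \<open>a\<^sub>0\<close> ends
  very close to \<open>a\<^sub>0\<close>: at the right end \<open>l 0\<close> differs from \<open>\<gamma>\<close> by only \<open>1.1 * 10 ^ (-15)\<close>. This
  requires a lower estimate of \<open>\<gamma>\<close> with an error below \<open>10 ^ (-15)\<close>, which comes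
  from the asymptotic expansion of the harmonic numbers at \<open>n = 32\<close>, proved by the same comparison of increments. Finally
  \<open>a\<^sub>0 < 8/15\<close>, and for the parameter \<open>8/15\<close> the numerator is positive as soon as \<open>z \<ge> 4\<close>;
  therefore \<open>\<gamma> < l n (8/15) < l n a\<^sub>0\<close> for all \<open>n \<ge> 1\<close>.
\<close>

section \<open>Comparing a sequence with its limit\<close>

text \<open>
  The increment \<open>G\<close> increases strictly to \<open>0\<close>, so it is negative. From \<open>n\<close> on the sequence is
  therefore strictly decreasing, and it stays above its limit.
\<close>

lemma less_limit_of_increment_increasing:
  fixes e :: "nat \<Rightarrow> real" and G G' :: "real \<Rightarrow> real"
  assumes lim: "e \<longlonglongrightarrow> L"
    and G: "\<And>n. real n \<ge> T \<Longrightarrow> e (Suc n) - e n = G (real n)"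
    and G0: "(G \<longlongrightarrow> 0) at_top"
    and deriv: "\<And>x. x \<ge> T \<Longrightarrow> (G has_real_derivative G' x) (at x)"
    and pos: "\<And>x. x \<ge> T \<Longrightarrow> G' x > 0"
    and n: "real n \<ge> T"
  shows "L < e n"
proof -
  have neg: "G x < 0" if "x \<ge> T" for x
  proof -
    have less: "G x < G y" if "x \<ge> T" "x < y" for x y
    proof (rule DERIV_pos_imp_increasing[OF \<open>x < y\<close>])
      fix t assume "x \<le> t" "t \<le> y"
      then have "t \<ge> T" using \<open>x \<ge> T\<close> by simp
      then show "\<exists>d. (G has_real_derivative d) (at t) \<and> d > 0"
        using deriv pos by blast
    qed
    have "eventually (\<lambda>y. G (x + 1) \<le> G y) at_top"
      using eventually_gt_at_top[of "x + 1"]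
      by eventually_elim (use less[of "x + 1"] \<open>x \<ge> T\<close> in force)
    then have "G (x + 1) \<le> 0"
      using tendsto_lowerbound[OF G0] trivial_limit_at_top_linorder by blast
    then show ?thesis using less[of x "x + 1"] \<open>x \<ge> T\<close> by simp
  qed
  have dec: "e (Suc k) < e k" if "k \<ge> n" for k
    using G[of k] neg[of "real k"] n that by (smt (verit) of_nat_le_iff)
  have "e k \<le> e (Suc n)" if "k \<ge> Suc n" for k
    using that
  proof (induction k rule: dec_induct)
    case (step m)
    then show ?case using dec[of m] by simp
  qed simp
  then have "L \<le> e (Suc n)"
    by (intro LIMSEQ_le_const2[OF lim]) blast
  then show ?thesis using dec[of n] by simp
qed

text \<open>
  The criterion is applied to \<open>harm n - \<phi> n\<close>, and to its negative for the reversed inequality. The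
  increment is \<open>1 / (x + 1) - \<phi> (x + 1) + \<phi> x\<close>, and the sign condition below concerns its derivative.
\<close>

lemma
  fixes \<phi> \<phi>' :: "real \<Rightarrow> real"
  assumes deriv: "\<And>x. x \<ge> T \<Longrightarrow> (\<phi> has_real_derivative \<phi>' x) (at x)"
    and asymp: "((\<lambda>x. \<phi> x - ln x) \<longlongrightarrow> 0) at_top"
    and n: "real n \<ge> T" and T: "T \<ge> 0"
  shows euler_mascheroni_less_harm_minus:
      "(\<And>x. x \<ge> T \<Longrightarrow> \<phi>' x - \<phi>' (x + 1) - 1 / (x + 1)\<^sup>2 > 0) \<Longrightarrow>
        euler_mascheroni < harm n - \<phi> (real n)"
    and harm_minus_less_euler_mascheroni:
      "(\<And>x. x \<ge> T \<Longrightarrow> \<phi>' x - \<phi>' (x + 1) - 1 / (x + 1)\<^sup>2 < 0) \<Longrightarrow>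
        harm n - \<phi> (real n) < euler_mascheroni"
proof -
  define G where "G = (\<lambda>x. 1 / (x + 1) - \<phi> (x + 1) + \<phi> x)"
  define G' where "G' = (\<lambda>x. \<phi>' x - \<phi>' (x + 1) - 1 / (x + 1)\<^sup>2)"
  define e where "e = (\<lambda>n. harm n - \<phi> (real n))"
  have "(\<lambda>n. (harm n - ln (real n)) - (\<phi> (real n) - ln (real n))) \<longlonglongrightarrow> euler_mascheroni - 0"
    by (intro tendsto_diff euler_mascheroni_LIMSEQ
          filterlim_compose[OF asymp filterlim_real_sequentially])
  then have lim: "e \<longlonglongrightarrow> euler_mascheroni"
    by (simp add: e_def)
  have step: "e (Suc k) - e k = G (real k)" for k
    by (simp add: e_def G_def harm_Suc field_simps add.commute)
  have "((\<lambda>x. 1 / (x + 1) - (ln (x + 1) - ln x) - (\<phi> (x + 1) - ln (x + 1)) + (\<phi> x - ln x))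
      \<longlongrightarrow> 0 - 0 - 0 + 0) at_top"
  proof (intro tendsto_add tendsto_diff asymp)
    show "((\<lambda>x::real. 1 / (x + 1)) \<longlongrightarrow> 0) at_top" by real_asymp
    show "((\<lambda>x::real. ln (x + 1) - ln x) \<longlongrightarrow> 0) at_top" by real_asymp
    show "((\<lambda>x. \<phi> (x + 1) - ln (x + 1)) \<longlongrightarrow> 0) at_top"
      by (rule filterlim_compose[OF asymp]) real_asymp
  qed
  then have G0: "(G \<longlongrightarrow> 0) at_top"
    by (simp add: G_def algebra_simps)
  have G': "(G has_real_derivative G' x) (at x)" if "x \<ge> T" for x
  proof -
    have "((\<lambda>x. \<phi> (x + 1)) has_real_derivative \<phi>' (x + 1)) (at x)"
      using deriv[of "x + 1"] that by (subst DERIV_shift[symmetric]) simp_all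
    moreover have "x + 1 \<noteq> 0" using T that by simp
    ultimately show ?thesis unfolding G_def G'_def
      by (auto intro!: derivative_eq_intros deriv that simp: power2_eq_square)
  qed
  show "euler_mascheroni < harm n - \<phi> (real n)"
    if "\<And>x. x \<ge> T \<Longrightarrow> \<phi>' x - \<phi>' (x + 1) - 1 / (x + 1)\<^sup>2 > 0"
    using less_limit_of_increment_increasing[OF lim step G0 G' _ n] that
    by (simp add: G'_def e_def)
  show "harm n - \<phi> (real n) < euler_mascheroni"
    if "\<And>x. x \<ge> T \<Longrightarrow> \<phi>' x - \<phi>' (x + 1) - 1 / (x + 1)\<^sup>2 < 0"
  proof -
    have "- euler_mascheroni < - e n"
      by (rule less_limit_of_increment_increasing
            [of "\<lambda>n. - e n" _ T "\<lambda>x. - G x" "\<lambda>x. - G' x"])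
         (use that tendsto_minus[OF lim] tendsto_minus[OF G0] step DERIV_minus[OF G'] n
          in \<open>simp_all add: G'_def algebra_simps\<close>)
    then show ?thesis by (simp add: e_def)
  qed
qed

section \<open>The weights and the shifts\<close>

text \<open>
  The numerator of the derivative of the increment, collected by powers of \<open>z = (x + 1)\<^sup>2\<close>. Here \<open>u\<close>
  and \<open>v\<close> are the shifts and \<open>P\<close> and \<open>Q\<close> are twice the weights.
\<close>

lemma numerator_expansion:
  fixes P Q u v z :: real
  shows "- (z\<^sup>2 + (2 * u - 1) * z + u\<^sup>2) * (z\<^sup>2 + (2 * v - 1) * z + v\<^sup>2)
      + P * z * (z - u) * (z\<^sup>2 + (2 * v - 1) * z + v\<^sup>2)
      + Q * z * (z - v) * (z\<^sup>2 + (2 * u - 1) * z + u\<^sup>2)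
    = (P + Q - 1) * z ^ 4
      + (P * (2 * v - 1 - u) + Q * (2 * u - 1 - v) - (2 * u - 1) - (2 * v - 1)) * z ^ 3
      + (P * (v\<^sup>2 - u * (2 * v - 1)) + Q * (u\<^sup>2 - v * (2 * u - 1))
          - (u\<^sup>2 + v\<^sup>2 + (2 * u - 1) * (2 * v - 1))) * z\<^sup>2
      + (- (2 * u - 1) * v\<^sup>2 - (2 * v - 1) * u\<^sup>2 - P * u * v\<^sup>2 - Q * v * u\<^sup>2) * z
      - u\<^sup>2 * v\<^sup>2"
  by (simp add: algebra_simps power2_eq_square power3_eq_cube power4_eq_xxxx)

text \<open>
  In terms of \<open>r = 1 / (45 a)\<close> the shifts are \<open>u = a + 1/3\<close> and \<open>v = 1/3 - r\<close>, and the weights are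
  proportional to \<open>r\<close> and \<open>a\<close>. The weights make the cubic coefficient vanish, and \<open>45 a r = 1\<close> makes
  the quadratic one vanish. All these hypotheses are polynomial relations, so the coefficients are
  found by reduction modulo an ideal, without any division.
\<close>

lemma numerator_coefficients:
  fixes a r P Q u v :: real
  assumes "45 * (a * r) = 1" and "P + Q = 1" and "P * a = Q * r"
    and "3 * u = 3 * a + 1" and "3 * v = 1 - 3 * r"
  shows "P * (2 * v - 1 - u) + Q * (2 * u - 1 - v) - (2 * u - 1) - (2 * v - 1) = 0"
    and "P * (v\<^sup>2 - u * (2 * v - 1)) + Q * (u\<^sup>2 - v * (2 * u - 1))
          - (u\<^sup>2 + v\<^sup>2 + (2 * u - 1) * (2 * v - 1)) = 0"
    and "135 * (- (2 * u - 1) * v\<^sup>2 - (2 * v - 1) * u\<^sup>2 - P * u * v\<^sup>2 - Q * v * u\<^sup>2)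
       = 16 - 21 * (a - r)"
  using assms by algebra+

definition upper_shift :: "real \<Rightarrow> real" where
  "upper_shift a = (3 * a + 1) / 3"

definition lower_shift :: "real \<Rightarrow> real" where
  "lower_shift a = (15 * a - 1) / (45 * a)"

definition log_mean :: "real \<Rightarrow> real \<Rightarrow> real" where
  "log_mean a x = 1 / (90 * a\<^sup>2 + 2) * ln (x\<^sup>2 + x + upper_shift a)
     + 45 * a\<^sup>2 / (90 * a\<^sup>2 + 2) * ln (x\<^sup>2 + x + lower_shift a)"

text \<open>
  The coefficient of \<open>z\<close> in the numerator \<open>c z - u\<^sup>2 v\<^sup>2\<close>; its sign decides on which side of
  \<open>\<gamma>\<close> the sequence \<open>l n a\<close> lies for large \<open>n\<close>.
\<close>

definition leading_coeff :: "real \<Rightarrow> real" where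
  "leading_coeff a = (16 - 21 * (a - 1 / (45 * a))) / 135"

lemma l_eq: "l n a = harm n - log_mean a (real n)"
  by (simp add: l_def log_mean_def upper_shift_def lower_shift_def)

lemma lower_shift_pos: "a > 1 / 15 \<Longrightarrow> lower_shift a > 0"
  by (simp add: lower_shift_def field_simps)

lemma upper_minus_lower_shift:
  "a > 1 / 15 \<Longrightarrow> upper_shift a - lower_shift a = (45 * a\<^sup>2 + 1) / (45 * a)"
  by (simp add: lower_shift_def upper_shift_def divide_simps power2_eq_square)
     (simp add: algebra_simps)

lemma lower_less_upper_shift:
  assumes "a > 1 / 15"
  shows "lower_shift a < upper_shift a"
proof -
  have "(45 * a\<^sup>2 + 1) / (45 * a) > 0"
    using assms by (intro divide_pos_pos add_nonneg_pos) auto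
  then show ?thesis using upper_minus_lower_shift[OF assms] by simp
qed

lemma has_derivative_log_shift:
  fixes x u :: real
  assumes "x \<ge> 0" and "u > 0"
  shows "((\<lambda>x. ln (x\<^sup>2 + x + u)) has_real_derivative (2 * x + 1) / (x\<^sup>2 + x + u)) (at x)"
proof -
  have "x\<^sup>2 + x + u > 0" using assms by (simp add: add_nonneg_pos)
  then show ?thesis
    by (auto intro!: derivative_eq_intros simp: field_simps)
qed

text \<open>
  With \<open>t = x + 1\<close> the two arguments are \<open>t\<^sup>2 - t + u\<close> and \<open>t\<^sup>2 + t + u\<close>, which are exchanged by
  \<open>t \<mapsto> - t\<close>. The difference is therefore even in \<open>t\<close>, that is, a rational function of \<open>z = t\<^sup>2\<close>, and
  the denominator is the product of the two arguments.
\<close>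

lemma log_shift_increment:
  fixes x u :: real
  assumes "x \<ge> 0" and "u > 0"
  defines "z \<equiv> (x + 1)\<^sup>2"
  shows "(2 * x + 1) / (x\<^sup>2 + x + u) - (2 * (x + 1) + 1) / ((x + 1)\<^sup>2 + (x + 1) + u)
      = 2 * ((z - u) / (z\<^sup>2 + (2 * u - 1) * z + u\<^sup>2))"
    and "z\<^sup>2 + (2 * u - 1) * z + u\<^sup>2 > 0"
proof -
  define A B where "A = x\<^sup>2 + x + u" and "B = (x + 1)\<^sup>2 + (x + 1) + u"
  have pos: "A > 0" "B > 0" using assms by (simp_all add: A_def B_def add_nonneg_pos)
  have AB: "z\<^sup>2 + (2 * u - 1) * z + u\<^sup>2 = A * B"
    unfolding A_def B_def z_def by algebra
  then show "z\<^sup>2 + (2 * u - 1) * z + u\<^sup>2 > 0" using pos by simp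
  have "(2 * x + 1) / A - (2 * (x + 1) + 1) / B = ((2 * x + 1) * B - (2 * (x + 1) + 1) * A) / (A * B)"
    using pos by (simp add: diff_frac_eq)
  also have "(2 * x + 1) * B - (2 * (x + 1) + 1) * A = 2 * (z - u)"
    unfolding A_def B_def z_def by algebra
  finally show "(2 * x + 1) / (x\<^sup>2 + x + u) - (2 * (x + 1) + 1) / ((x + 1)\<^sup>2 + (x + 1) + u)
      = 2 * ((z - u) / (z\<^sup>2 + (2 * u - 1) * z + u\<^sup>2))"
    by (simp add: AB A_def B_def)
qed

definition log_mean' :: "real \<Rightarrow> real \<Rightarrow> real" where
  "log_mean' a x = 1 / (90 * a\<^sup>2 + 2) * ((2 * x + 1) / (x\<^sup>2 + x + upper_shift a))
     + 45 * a\<^sup>2 / (90 * a\<^sup>2 + 2) * ((2 * x + 1) / (x\<^sup>2 + x + lower_shift a))"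

lemma log_mean_has_derivative:
  assumes "a > 1 / 15" and "x \<ge> 0"
  shows "(log_mean a has_real_derivative log_mean' a x) (at x)"
  unfolding log_mean_def[abs_def] log_mean'_def
  using assms lower_shift_pos[of a] lower_less_upper_shift[of a]
  by (intro DERIV_add DERIV_cmult has_derivative_log_shift) auto

text \<open>
  Bringing the difference to a common denominator leads to the numerator expanded above, in which only
  the linear and the constant term survive.
\<close>

lemma log_mean_increment_derivative:
  assumes a: "a > 1 / 15" and x: "x \<ge> 0"
  defines "u \<equiv> upper_shift a" and "v \<equiv> lower_shift a" and "z \<equiv> (x + 1)\<^sup>2"
  shows "\<exists>d>0. log_mean' a x - log_mean' a (x + 1) - 1 / (x + 1)\<^sup>2
            = (leading_coeff a * z - u\<^sup>2 * v\<^sup>2) / d"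
proof -
  define P Q r where "P = 1 / (45 * a\<^sup>2 + 1)" and "Q = 45 * a\<^sup>2 / (45 * a\<^sup>2 + 1)"
    and "r = 1 / (45 * a)"
  define U V where "U = z\<^sup>2 + (2 * u - 1) * z + u\<^sup>2" and "V = z\<^sup>2 + (2 * v - 1) * z + v\<^sup>2"
  have "45 * a\<^sup>2 + 1 > 0" by (simp add: add_nonneg_pos)
  have rel: "45 * (a * r) = 1" "P + Q = 1" "P * a = Q * r"
      "3 * u = 3 * a + 1" "3 * v = 1 - 3 * r"
    using a \<open>45 * a\<^sup>2 + 1 > 0\<close>
    by (simp_all add: P_def Q_def r_def u_def v_def upper_shift_def lower_shift_def
          power2_eq_square add_divide_distrib[symmetric] diff_divide_distrib)
  note coeff = numerator_coefficients[OF rel]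
  have uv: "u > 0" "v > 0"
    using a lower_shift_pos[of a] lower_less_upper_shift[of a] by (auto simp: u_def v_def)
  have "z > 0" using x by (simp add: z_def)
  have UV: "U > 0" "V > 0"
    using log_shift_increment(2)[OF x uv(1)] log_shift_increment(2)[OF x uv(2)]
    by (simp_all add: U_def V_def z_def)
  have inc: "(2 * x + 1) / (x\<^sup>2 + x + w) - (2 * (x + 1) + 1) / ((x + 1)\<^sup>2 + (x + 1) + w)
      = 2 * ((z - w) / (z\<^sup>2 + (2 * w - 1) * z + w\<^sup>2))" if "w > 0" for w
    unfolding z_def by (rule log_shift_increment(1)[OF x that])
  have half_double: "c / 2 * (2 * y) = c * y" for c y :: real by simp
  have half: "1 / (90 * a\<^sup>2 + 2) = P / 2" "45 * a\<^sup>2 / (90 * a\<^sup>2 + 2) = Q / 2"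
    using \<open>45 * a\<^sup>2 + 1 > 0\<close> by (simp_all add: P_def Q_def divide_simps)
  have "log_mean' a x - log_mean' a (x + 1) =
      P / 2 * ((2 * x + 1) / (x\<^sup>2 + x + u) - (2 * (x + 1) + 1) / ((x + 1)\<^sup>2 + (x + 1) + u))
    + Q / 2 * ((2 * x + 1) / (x\<^sup>2 + x + v) - (2 * (x + 1) + 1) / ((x + 1)\<^sup>2 + (x + 1) + v))"
    unfolding log_mean'_def half u_def v_def by (simp only: right_diff_distrib)
  also have "\<dots> = P * ((z - u) / U) + Q * ((z - v) / V)"
    unfolding inc[OF uv(1)] inc[OF uv(2)] U_def[symmetric] V_def[symmetric]
    by (simp only: half_double)
  finally have "log_mean' a x - log_mean' a (x + 1) - 1 / (x + 1)\<^sup>2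
      = P * ((z - u) / U) + Q * ((z - v) / V) - 1 / z"
    by (simp add: z_def)
  also have "\<dots> = (- U * V + P * z * (z - u) * V + Q * z * (z - v) * U) / (z * U * V)"
    using UV \<open>z > 0\<close> by (simp add: divide_simps) (simp add: algebra_simps)
  also have "- U * V + P * z * (z - u) * V + Q * z * (z - v) * U = leading_coeff a * z - u\<^sup>2 * v\<^sup>2"
  proof -
    have "- (2 * u - 1) * v\<^sup>2 - (2 * v - 1) * u\<^sup>2 - P * u * v\<^sup>2 - Q * v * u\<^sup>2 = leading_coeff a"
      using coeff(3) by (simp add: leading_coeff_def r_def)
    then show ?thesis
      unfolding U_def V_def numerator_expansion coeff(1,2) using rel(2) by simp
  qed
  finally show ?thesis
    using UV \<open>z > 0\<close> by (intro exI[of _ "z * U * V"]) simp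
qed

text \<open>
  The weights add up to one half and each logarithm is \<open>2 ln x + o(1)\<close>.
\<close>

lemma log_mean_asymp:
  assumes "a > 1 / 15"
  shows "((\<lambda>x. log_mean a x - ln x) \<longlongrightarrow> 0) at_top"
proof -
  have *: "((\<lambda>x::real. ln (x\<^sup>2 + x + w) - 2 * ln x) \<longlongrightarrow> 0) at_top" for w :: real
    by real_asymp
  have weights: "p * y + q * z - t = p * (y - 2 * t) + q * (z - 2 * t)"
    if "p + q = 1 / 2" for p q y z t :: real
    using that by algebra
  have "1 / (90 * a\<^sup>2 + 2) + 45 * a\<^sup>2 / (90 * a\<^sup>2 + 2) = 1 / 2"
    by (simp add: add_divide_distrib[symmetric] divide_simps) (smt (verit) zero_le_power2)
  from weights[OF this] have "log_mean a x - ln x =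
      1 / (90 * a\<^sup>2 + 2) * (ln (x\<^sup>2 + x + upper_shift a) - 2 * ln x)
      + 45 * a\<^sup>2 / (90 * a\<^sup>2 + 2) * (ln (x\<^sup>2 + x + lower_shift a) - 2 * ln x)" for x
    unfolding log_mean_def .
  note eq = this
  show ?thesis
    unfolding eq
    by (rule tendsto_eq_rhs[OF tendsto_add[OF tendsto_mult_left[OF *] tendsto_mult_left[OF *]]]) simp
qed

section \<open>Comparing \<open>l n a\<close> with \<open>\<gamma>\<close>\<close>

lemma euler_mascheroni_less_l:
  assumes a: "a > 1 / 15"
    and pos: "leading_coeff a > 0"
    and n: "(upper_shift a)\<^sup>2 * (lower_shift a)\<^sup>2 < leading_coeff a * (real n + 1)\<^sup>2"
  shows "euler_mascheroni < l n a"
  unfolding l_eq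
proof (rule euler_mascheroni_less_harm_minus)
  fix x assume x: "real n \<le> x"
  have "leading_coeff a * (real n + 1)\<^sup>2 \<le> leading_coeff a * (x + 1)\<^sup>2"
    using x pos by (intro mult_left_mono power_mono) auto
  with n have num: "leading_coeff a * (x + 1)\<^sup>2 - (upper_shift a)\<^sup>2 * (lower_shift a)\<^sup>2 > 0"
    by linarith
  obtain d where d: "d > 0" "log_mean' a x - log_mean' a (x + 1) - 1 / (x + 1)\<^sup>2
      = (leading_coeff a * (x + 1)\<^sup>2 - (upper_shift a)\<^sup>2 * (lower_shift a)\<^sup>2) / d"
    using log_mean_increment_derivative[OF a, of x] x by auto
  show "log_mean' a x - log_mean' a (x + 1) - 1 / (x + 1)\<^sup>2 > 0"
    unfolding d(2) by (rule divide_pos_pos[OF num d(1)])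
qed (use log_mean_has_derivative[OF a] log_mean_asymp[OF a] in auto)

lemma l_less_euler_mascheroni:
  assumes a: "a > 1 / 15" and nonpos: "leading_coeff a \<le> 0"
  shows "l n a < euler_mascheroni"
  unfolding l_eq
proof (rule harm_minus_less_euler_mascheroni)
  fix x assume x: "real n \<le> x"
  have "upper_shift a > 0" "lower_shift a > 0"
    using lower_shift_pos[OF a] lower_less_upper_shift[OF a] by auto
  then have "0 < (upper_shift a)\<^sup>2 * (lower_shift a)\<^sup>2" by simp
  moreover have "leading_coeff a * (x + 1)\<^sup>2 \<le> 0"
    using nonpos by (simp add: mult_nonpos_nonneg)
  ultimately have num: "leading_coeff a * (x + 1)\<^sup>2 - (upper_shift a)\<^sup>2 * (lower_shift a)\<^sup>2 < 0"
    by linarith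
  obtain d where d: "d > 0" "log_mean' a x - log_mean' a (x + 1) - 1 / (x + 1)\<^sup>2
      = (leading_coeff a * (x + 1)\<^sup>2 - (upper_shift a)\<^sup>2 * (lower_shift a)\<^sup>2) / d"
    using log_mean_increment_derivative[OF a, of x] x by auto
  show "log_mean' a x - log_mean' a (x + 1) - 1 / (x + 1)\<^sup>2 < 0"
    unfolding d(2) by (rule divide_neg_pos[OF num d(1)])
qed (use log_mean_has_derivative[OF a] log_mean_asymp[OF a] in auto)

text \<open>
  The equation \<open>leading_coeff a = 0\<close> is equivalent to \<open>105 a\<^sup>2 - 80 a - 7/3 = 0\<close>, whose positive root
  is \<open>a\<^sub>1\<close>.
\<close>

lemma leading_coeff_a\<^sub>1: "leading_coeff a\<^sub>1 = 0"
  and a\<^sub>1_gt: "a\<^sub>1 > 1 / 15"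
proof -
  have "a\<^sub>1 > 0" by (simp add: a\<^sub>1_def add_pos_nonneg)
  show "a\<^sub>1 > 1 / 15" by (simp add: a\<^sub>1_def add_pos_nonneg field_simps)
  have "105 * a\<^sub>1\<^sup>2 - 80 * a\<^sub>1 - 7 / 3 = 0"
    by (simp add: a\<^sub>1_def field_simps power2_eq_square)
  with \<open>a\<^sub>1 > 0\<close> show "leading_coeff a\<^sub>1 = 0"
    by (simp add: leading_coeff_def field_simps power2_eq_square)
qed

lemma leading_coeff_strict_antimono:
  assumes "0 < a" and "a < b"
  shows "leading_coeff b < leading_coeff a"
proof -
  have "1 / (45 * b) < 1 / (45 * a)" using assms by (simp add: field_simps)
  then show ?thesis using assms by (simp add: leading_coeff_def)
qed

section \<open>Monotonicity in the parameter\<close>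

text \<open>
  The trapezoidal rule strictly overestimates the integral of the strictly convex function \<open>1/t\<close>. The
  excess, as a function of the right end \<open>x\<close>, has derivative \<open>(x - B)\<^sup>2 / (B x\<^sup>2)\<close>.
\<close>

lemma ln_diff_less_trapezoid:
  fixes A B :: real
  assumes "0 < B" and "B < A"
  shows "2 * (ln A - ln B) < (A - B) * (1 / A + 1 / B)"
proof -
  define f where "f = (\<lambda>x::real. (x - B) * (1 / x + 1 / B) - 2 * ln x)"
  have "f B < f A"
  proof (rule DERIV_pos_imp_increasing_open[OF \<open>B < A\<close>])
    fix x assume x: "B < x" "x < A"
    have "(f has_real_derivative (1 * (1 / x + 1 / B) + (x - B) * (- 1 / x\<^sup>2) - 2 * (1 / x))) (at x)"
      unfolding f_def using x \<open>0 < B\<close>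
      by (auto intro!: derivative_eq_intros simp: power2_eq_square)
    also have "1 * (1 / x + 1 / B) + (x - B) * (- 1 / x\<^sup>2) - 2 * (1 / x) = (x - B)\<^sup>2 / (B * x\<^sup>2)"
      using x \<open>0 < B\<close> by (simp add: divide_simps power2_eq_square) (simp add: algebra_simps)
    finally have "(f has_real_derivative (x - B)\<^sup>2 / (B * x\<^sup>2)) (at x)" .
    moreover have "(x - B)\<^sup>2 / (B * x\<^sup>2) > 0" using x \<open>0 < B\<close> by simp
    ultimately show "\<exists>y. (f has_real_derivative y) (at x) \<and> y > 0" by blast
  next
    show "continuous_on {B..A} f"
      unfolding f_def using \<open>0 < B\<close> by (auto intro!: continuous_intros)
  qed
  then show ?thesis by (simp add: f_def)
qed

text \<open>
  With \<open>p = 1 / (90 a\<^sup>2 + 2)\<close> both shifts contribute the same factor \<open>p\<close> to the derivative, since the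
  derivative \<open>1 / (45 a\<^sup>2)\<close> of the lower shift cancels the numerator of its weight. The weights
  contribute \<open>- 180 a p\<^sup>2 (ln A - ln B)\<close>, and \<open>90 a p (A - B) = 1\<close> turns the sum into a positive
  multiple of the trapezoidal excess.
\<close>

lemma log_mean_has_parameter_derivative:
  assumes a: "a > 1 / 15" and x: "x \<ge> 0"
  shows "\<exists>d>0. ((\<lambda>a. log_mean a x) has_real_derivative d) (at a)"
proof -
  define A B p where "A = x\<^sup>2 + x + upper_shift a" and "B = x\<^sup>2 + x + lower_shift a"
    and "p = 1 / (90 * a\<^sup>2 + 2)"
  have B: "B > 0" and AB: "B < A"
    using x lower_shift_pos[OF a] lower_less_upper_shift[OF a]
    by (auto simp: A_def B_def add_nonneg_pos)
  have a0: "a > 0" "a \<noteq> 0" using a by auto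
  have den: "90 * a\<^sup>2 + 2 > 0" by (simp add: add_nonneg_pos)
  have diff: "p * (90 * a * (A - B)) = 1"
  proof -
    have "90 * a * (A - B) = 90 * a\<^sup>2 + 2"
      using upper_minus_lower_shift[OF a] a0 by (simp add: A_def B_def field_simps)
    then show ?thesis using den by (simp add: p_def)
  qed
  have w: "((\<lambda>a. 1 / (90 * a\<^sup>2 + 2)) has_real_derivative - (180 * a * p\<^sup>2)) (at a)"
    "((\<lambda>a. 45 * a\<^sup>2 / (90 * a\<^sup>2 + 2)) has_real_derivative 180 * a * p\<^sup>2) (at a)"
    using den
    by (auto intro!: derivative_eq_intros simp: p_def power2_eq_square divide_simps)
       (simp add: algebra_simps)
  have lnA: "((\<lambda>a. ln (x\<^sup>2 + x + upper_shift a)) has_real_derivative 1 / A) (at a)"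
    using B AB unfolding A_def upper_shift_def
    by (auto intro!: derivative_eq_intros simp: divide_simps)
  have "(lower_shift has_real_derivative 1 / (45 * a\<^sup>2)) (at a)"
    unfolding lower_shift_def[abs_def] using a0
    by (auto intro!: derivative_eq_intros simp: divide_simps power2_eq_square)
  then have lnB: "((\<lambda>a. ln (x\<^sup>2 + x + lower_shift a)) has_real_derivative
      1 / (45 * a\<^sup>2) / B) (at a)"
    using B unfolding B_def by (auto intro!: derivative_eq_intros)
  have "((\<lambda>a. log_mean a x) has_real_derivative
      (- (180 * a * p\<^sup>2) * ln A + 1 / A * p)
      + (180 * a * p\<^sup>2 * ln B + 1 / (45 * a\<^sup>2) / B * (45 * a\<^sup>2 / (90 * a\<^sup>2 + 2)))) (at a)"
    unfolding log_mean_def A_def B_def p_def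
    by (intro DERIV_add DERIV_mult w[unfolded p_def] lnA[unfolded A_def] lnB[unfolded B_def])
  moreover have "(- (180 * a * p\<^sup>2) * ln A + 1 / A * p)
      + (180 * a * p\<^sup>2 * ln B + 1 / (45 * a\<^sup>2) / B * (45 * a\<^sup>2 / (90 * a\<^sup>2 + 2)))
      = 90 * a * p\<^sup>2 * ((A - B) * (1 / A + 1 / B) - 2 * (ln A - ln B))"
  proof -
    have "1 / (45 * a\<^sup>2) / B * (45 * a\<^sup>2 / (90 * a\<^sup>2 + 2)) = 1 / B * p"
      using a0 by (simp add: p_def)
    moreover have "90 * a * p\<^sup>2 * ((A - B) * s - 2 * t) = p * s - 180 * a * p\<^sup>2 * t" for s t
      using diff by algebra
    ultimately show ?thesis by (simp only:) (simp add: algebra_simps)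
  qed
  moreover have "90 * a * p\<^sup>2 * ((A - B) * (1 / A + 1 / B) - 2 * (ln A - ln B)) > 0"
    using ln_diff_less_trapezoid[OF B AB] a0 den by (simp add: p_def)
  ultimately show ?thesis by metis
qed

lemma l_strict_antimono: "strict_antimono_on {1/15<..} (l n)"
proof (rule monotone_onI)
  fix a b :: real assume ab: "a \<in> {1/15<..}" "b \<in> {1/15<..}" "a < b"
  have "log_mean a (real n) < log_mean b (real n)"
  proof (rule DERIV_pos_imp_increasing[OF \<open>a < b\<close>])
    fix c assume "a \<le> c" "c \<le> b"
    then show "\<exists>d. ((\<lambda>a. log_mean a (real n)) has_real_derivative d) (at c) \<and> d > 0"
      using ab log_mean_has_parameter_derivative[of c "real n"] by auto
  qed
  then show "l n b < l n a" by (simp add: l_eq)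
qed

lemma l_continuous: "continuous_on {1/15<..} (l n)"
  unfolding l_eq[abs_def]
proof (intro continuous_intros continuous_at_imp_continuous_on ballI)
  fix a :: real assume "a \<in> {1/15<..}"
  then show "isCont (\<lambda>a. log_mean a (real n)) a"
    using log_mean_has_parameter_derivative[of a "real n"] DERIV_isCont by auto
qed

section \<open>Numerical bounds for \<open>\<gamma>\<close>\<close>

lemma ln_2_bounds:
  "0.69314718055994530941 < ln (2::real)" "ln (2::real) < 0.69314718055994530942"
  using ln_approx_bounds[of "2::real" 21]
  by (simp_all add: lessThan_nat_numeral power_divide)

lemma has_derivative_divide_power:
  fixes x c :: real
  assumes "x \<noteq> 0"
  shows "((\<lambda>x. c / x ^ k) has_real_derivative - (c * real k) / x ^ Suc k) (at x)"
proof -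
  have "((\<lambda>x. c / x ^ k) has_real_derivative
      (0 * x ^ k - c * (real k * x ^ (k - 1))) / (x ^ k * x ^ k)) (at x)"
    using assms by (auto intro!: derivative_eq_intros)
  also have "(0 * x ^ k - c * (real k * x ^ (k - 1))) / (x ^ k * x ^ k) = - (c * real k) / x ^ Suc k"
    using assms by (cases k) (simp_all add: divide_simps)
  finally show ?thesis .
qed

text \<open>
  Truncations of the asymptotic expansion of the harmonic numbers alternately under- and overestimate
  them. For \<open>\<phi>(x) = ln x + 1/(2x) - \<dots>\<close> the derivative of the increment has, over the
  common denominator \<open>x ^ k * (x + 1) ^ k\<close>, a numerator whose coefficients all have the same sign,
  which settles both truncations used here.
\<close>

lemma euler_mascheroni_less_expansion:
  assumes "n \<ge> 1"
  shows "euler_mascheroni < harm n - (ln (real n) + 1 / 2 / real n - 1 / 12 / real n ^ 2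
    + 1 / 120 / real n ^ 4 - 1 / 252 / real n ^ 6)"
proof (rule euler_mascheroni_less_harm_minus[where T = 1])
  fix x :: real assume x: "x \<ge> 1"
  note deriv = has_derivative_divide_power[where x = x]
  show "((\<lambda>x. ln x + 1 / 2 / x - 1 / 12 / x ^ 2 + 1 / 120 / x ^ 4 - 1 / 252 / x ^ 6)
    has_real_derivative (1 / x - 1 / 2 / x ^ 2 + 1 / 6 / x ^ 3 - 1 / 30 / x ^ 5 + 1 / 42 / x ^ 7)) (at x)"
    using x by (auto intro!: derivative_eq_intros deriv simp: eval_nat_numeral)
next
  fix x :: real assume x: "x \<ge> 1"
  define y where "y = x + 1"
  have "x \<noteq> 0" "y \<noteq> 0" using x by (simp_all add: y_def)
  have "1 / x - 1 / 2 / x ^ 2 + 1 / 6 / x ^ 3 - 1 / 30 / x ^ 5 + 1 / 42 / x ^ 7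
      - (1 / y - 1 / 2 / y ^ 2 + 1 / 6 / y ^ 3 - 1 / 30 / y ^ 5 + 1 / 42 / y ^ 7) - 1 / y\<^sup>2
    = (210 * (x ^ 6 * y ^ 7 - x ^ 7 * y ^ 6) - 105 * (x ^ 5 * y ^ 7 - x ^ 7 * y ^ 5)
      + 35 * (x ^ 4 * y ^ 7 - x ^ 7 * y ^ 4) - 7 * (x ^ 2 * y ^ 7 - x ^ 7 * y ^ 2) + 5 * (y ^ 7
        - x ^ 7) - 210 * x ^ 7 * y ^ 5)
      / (210 * x ^ 7 * y ^ 7)"
    using \<open>x \<noteq> 0\<close> \<open>y \<noteq> 0\<close> by (simp add: divide_simps eval_nat_numeral) (simp add: algebra_simps)
  also have "210 * (x ^ 6 * y ^ 7 - x ^ 7 * y ^ 6) - 105 * (x ^ 5 * y ^ 7 - x ^ 7 * y ^ 5)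
    + 35 * (x ^ 4 * y ^ 7 - x ^ 7 * y ^ 4) - 7 * (x ^ 2 * y ^ 7 - x ^ 7 * y ^ 2)
    + 5 * (y ^ 7 - x ^ 7) - 210 * x ^ 7 * y ^ 5
      = 5 + 35 * x + 98 * x ^ 2 + 126 * x ^ 3 + 63 * x ^ 4"
    unfolding y_def by (simp add: algebra_simps eval_nat_numeral)
  also have "(5 + 35 * x + 98 * x ^ 2 + 126 * x ^ 3 + 63 * x ^ 4) / (210 * x ^ 7 * y ^ 7) > 0"
    using x by (intro divide_pos_pos) (auto simp: y_def add_pos_pos add_pos_nonneg)
  finally show "1 / x - 1 / 2 / x ^ 2 + 1 / 6 / x ^ 3 - 1 / 30 / x ^ 5 + 1 / 42 / x ^ 7
      - (1 / (x + 1) - 1 / 2 / (x + 1) ^ 2 + 1 / 6 / (x + 1) ^ 3 - 1 / 30 / (x + 1) ^ 5 + 1 / 42 / (x + 1) ^ 7) - 1 / (x + 1)\<^sup>2 > 0"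
    unfolding y_def .
next
  show "((\<lambda>x::real. ln x + 1 / 2 / x - 1 / 12 / x ^ 2 + 1 / 120 / x ^ 4 - 1 / 252 / x ^ 6
    - ln x) \<longlongrightarrow> 0) at_top"
    by real_asymp
qed (use assms in auto)

lemma expansion_less_euler_mascheroni:
  assumes "n \<ge> 1"
  shows "harm n - (ln (real n) + 1 / 2 / real n - 1 / 12 / real n ^ 2 + 1 / 120 / real n ^ 4
    - 1 / 252 / real n ^ 6 + 1 / 240 / real n ^ 8) < euler_mascheroni"
proof (rule harm_minus_less_euler_mascheroni[where T = 1])
  fix x :: real assume x: "x \<ge> 1"
  note deriv = has_derivative_divide_power[where x = x]
  show "((\<lambda>x. ln x + 1 / 2 / x - 1 / 12 / x ^ 2 + 1 / 120 / x ^ 4 - 1 / 252 / x ^ 6 + 1 / 240 / x ^ 8)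
    has_real_derivative (1 / x - 1 / 2 / x ^ 2 + 1 / 6 / x ^ 3 - 1 / 30 / x ^ 5 + 1 / 42 / x ^ 7
      - 1 / 30 / x ^ 9)) (at x)"
    using x by (auto intro!: derivative_eq_intros deriv simp: eval_nat_numeral)
next
  fix x :: real assume x: "x \<ge> 1"
  define y where "y = x + 1"
  have "x \<noteq> 0" "y \<noteq> 0" using x by (simp_all add: y_def)
  have "1 / x - 1 / 2 / x ^ 2 + 1 / 6 / x ^ 3 - 1 / 30 / x ^ 5 + 1 / 42 / x ^ 7 - 1 / 30 / x ^ 9
      - (1 / y - 1 / 2 / y ^ 2 + 1 / 6 / y ^ 3 - 1 / 30 / y ^ 5 + 1 / 42 / y ^ 7 - 1 / 30 / y ^ 9) - 1 / y\<^sup>2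
    = (210 * (x ^ 8 * y ^ 9 - x ^ 9 * y ^ 8) - 105 * (x ^ 7 * y ^ 9 - x ^ 9 * y ^ 7)
      + 35 * (x ^ 6 * y ^ 9 - x ^ 9 * y ^ 6) - 7 * (x ^ 4 * y ^ 9 - x ^ 9 * y ^ 4)
        + 5 * (x ^ 2 * y ^ 9 - x ^ 9 * y ^ 2) - 7 * (y ^ 9 - x ^ 9) - 210 * x ^ 9 * y ^ 7)
      / (210 * x ^ 9 * y ^ 9)"
    using \<open>x \<noteq> 0\<close> \<open>y \<noteq> 0\<close> by (simp add: divide_simps eval_nat_numeral) (simp add: algebra_simps)
  also have "210 * (x ^ 8 * y ^ 9 - x ^ 9 * y ^ 8) - 105 * (x ^ 7 * y ^ 9 - x ^ 9 * y ^ 7)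
    + 35 * (x ^ 6 * y ^ 9 - x ^ 9 * y ^ 6) - 7 * (x ^ 4 * y ^ 9 - x ^ 9 * y ^ 4)
      + 5 * (x ^ 2 * y ^ 9 - x ^ 9 * y ^ 2) - 7 * (y ^ 9 - x ^ 9) - 210 * x ^ 9 * y ^ 7
      = - (7 + 63 * x + 247 * x ^ 2 + 543 * x ^ 3 + 709 * x ^ 4 + 525 * x ^ 5 + 175 * x ^ 6)"
    unfolding y_def by (simp add: algebra_simps eval_nat_numeral)
  also have "(- (7 + 63 * x + 247 * x ^ 2 + 543 * x ^ 3 + 709 * x ^ 4 + 525 * x ^ 5
    + 175 * x ^ 6)) / (210 * x ^ 9 * y ^ 9) < 0"
  proof (rule divide_neg_pos)
    have "7 + 63 * x + 247 * x ^ 2 + 543 * x ^ 3 + 709 * x ^ 4 + 525 * x ^ 5 + 175 * x ^ 6 > 0"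
      using x by (intro add_pos_pos) auto
    then show "- (7 + 63 * x + 247 * x ^ 2 + 543 * x ^ 3 + 709 * x ^ 4 + 525 * x ^ 5 + 175 * x ^ 6) < 0"
      by linarith
  qed (use x in \<open>simp add: y_def\<close>)
  finally show "1 / x - 1 / 2 / x ^ 2 + 1 / 6 / x ^ 3 - 1 / 30 / x ^ 5 + 1 / 42 / x ^ 7 - 1 / 30 / x ^ 9
      - (1 / (x + 1) - 1 / 2 / (x + 1) ^ 2 + 1 / 6 / (x + 1) ^ 3 - 1 / 30 / (x + 1) ^ 5 + 1 / 42 / (x + 1) ^ 7 - 1 / 30 / (x + 1) ^ 9) - 1 / (x + 1)\<^sup>2 < 0"
    unfolding y_def .
next
  show "((\<lambda>x::real. ln x + 1 / 2 / x - 1 / 12 / x ^ 2 + 1 / 120 / x ^ 4 - 1 / 252 / x ^ 6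
    + 1 / 240 / x ^ 8 - ln x) \<longlongrightarrow> 0) at_top"
    by real_asymp
qed (use assms in auto)

text \<open>
  At \<open>n = 32\<close> the errors of the two truncations are about \<open>1 / (132 * 32 ^ 10)\<close>, which is
  \<open>7 * 10 ^ (-18)\<close>, and \<open>1 / (240 * 32 ^ 8)\<close>, which is \<open>4 * 10 ^ (-15)\<close>; and \<open>ln 32\<close> is a multiple of
  \<open>ln 2\<close>. The lower bound has to be the sharper one.
\<close>

lemma euler_mascheroni_numeric_bounds:
  "0.57721566490153285 < (euler_mascheroni :: real)"
  "(euler_mascheroni :: real) < 0.577215664901537"
proof -
  have ln: "ln (real 32) = 5 * ln 2"
    using ln_realpow[of 2 5] by simp
  show "0.57721566490153285 < (euler_mascheroni :: real)"
    using expansion_less_euler_mascheroni[of 32] ln_2_bounds unfolding ln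
    by (simp add: harm_expand)
  show "(euler_mascheroni :: real) < 0.577215664901537"
    using euler_mascheroni_less_expansion[of 32] ln_2_bounds unfolding ln
    by (simp add: harm_expand)
qed

section \<open>Locating the root\<close>

lemma ln_13_11_bounds:
  "0.16705408466316619199 < ln (13 / 11 :: real)" "ln (13 / 11 :: real) < 0.16705408466316619200"
  using ln_approx_bounds[of "13 / 11 :: real" 9]
  by (simp_all add: lessThan_nat_numeral power_divide)

lemma ln_29_25_bounds:
  "0.14842000511827327798 < ln (29 / 25 :: real)" "ln (29 / 25 :: real) < 0.14842000511827327799"
  using ln_approx_bounds[of "29 / 25 :: real" 9]
  by (simp_all add: lessThan_nat_numeral power_divide)

text \<open>
  Near \<open>a\<^sub>0\<close> the shifts are close to \<open>11/13\<close> and \<open>29/100\<close>. Splitting off these values leaves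
  logarithms of numbers within \<open>2 * 10 ^ (-4)\<close> of \<open>1\<close>, for which two terms of the logarithmic series
  suffice. Since \<open>29/100 = (29/25) / 4\<close>, the remaining logarithms are those of \<open>13/11\<close>, \<open>29/25\<close> and
  \<open>2\<close>.
\<close>

lemma l_0_eq:
  assumes "a > 1 / 15"
  shows "(90 * a\<^sup>2 + 2) * l 0 a = ln (13 / 11) - ln (13 / 11 * upper_shift a)
    - 45 * a\<^sup>2 * (ln (29 / 25) + ln (100 / 29 * lower_shift a) - 2 * ln 2)"
proof -
  define d where "d = 90 * a\<^sup>2 + 2"
  have "d > 0" by (simp add: d_def add_nonneg_pos)
  have pos: "upper_shift a > 0" "lower_shift a > 0"
    using lower_shift_pos[OF assms] lower_less_upper_shift[OF assms] by auto
  have "ln (29 / 25 * (100 / 29 * lower_shift a)) = ln (29 / 25) + ln (100 / 29 * lower_shift a)"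
    using pos by (intro ln_mult_pos) auto
  moreover have "ln (4 * lower_shift a) = ln 4 + ln (lower_shift a)"
    using pos by (intro ln_mult_pos) auto
  moreover have "ln (4::real) = 2 * ln 2"
    using ln_realpow[of 2 2] by simp
  ultimately have v: "ln (lower_shift a) = ln (29 / 25) + ln (100 / 29 * lower_shift a) - 2 * ln 2"
    by simp
  have u: "ln (upper_shift a) = ln (13 / 11 * upper_shift a) - ln (13 / 11)"
    using pos by (subst ln_mult_pos) auto
  have "d * l 0 a = - ln (upper_shift a) - 45 * a\<^sup>2 * ln (lower_shift a)"
  proof -
    have "l 0 a = - (1 / d * ln (upper_shift a)) - 45 * a\<^sup>2 / d * ln (lower_shift a)"
      by (simp add: l_eq log_mean_def harm_def d_def)
    then show ?thesis using \<open>d > 0\<close> by (simp add: field_simps)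
  qed
  then show ?thesis by (simp add: u v d_def)
qed

text \<open>
  The difference to \<open>\<gamma>\<close> is about \<open>1.1 * 10 ^ (-15)\<close> here, and \<open>2.9 * 10 ^ (-14)\<close> at the lower end.
\<close>

lemma l_0_upper_end: "l 0 0.5129670714025 < euler_mascheroni"
proof -
  have "ln (13 / 11 * upper_shift 0.5129670714025) \<ge> 0.000173190598536383"
    using ln_approx_bounds[of "13 / 11 * upper_shift 0.5129670714025" 2]
    by (simp add: upper_shift_def lessThan_nat_numeral power_divide)
  moreover have "ln (100 / 29 * lower_shift 0.5129670714025) \<ge> 0.00004269102637351"
    using ln_approx_bounds[of "100 / 29 * lower_shift 0.5129670714025" 2]
    by (simp add: lower_shift_def lessThan_nat_numeral power_divide)
  ultimately have "(90 * 0.5129670714025\<^sup>2 + 2) * l 0 0.5129670714025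
      < (90 * 0.5129670714025\<^sup>2 + 2) * euler_mascheroni"
    using ln_2_bounds ln_13_11_bounds ln_29_25_bounds euler_mascheroni_numeric_bounds(1)
    by (subst l_0_eq; simp add: power_divide add_divide_distrib diff_divide_distrib)
  then show ?thesis
    by (rule mult_left_less_imp_less) simp
qed

lemma l_0_lower_end: "euler_mascheroni < l 0 0.5129670714015"
proof -
  have "ln (13 / 11 * upper_shift 0.5129670714015) \<le> 0.00017319059735477"
    using ln_approx_bounds[of "13 / 11 * upper_shift 0.5129670714015" 2]
    by (simp add: upper_shift_def lessThan_nat_numeral power_divide)
  moreover have "ln (100 / 29 * lower_shift 0.5129670714015) \<le> 0.00004269102608231"
    using ln_approx_bounds[of "100 / 29 * lower_shift 0.5129670714015" 2]
    by (simp add: lower_shift_def lessThan_nat_numeral power_divide)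
  ultimately have "(90 * 0.5129670714015\<^sup>2 + 2) * euler_mascheroni
      < (90 * 0.5129670714015\<^sup>2 + 2) * l 0 0.5129670714015"
    using ln_2_bounds ln_13_11_bounds ln_29_25_bounds euler_mascheroni_numeric_bounds(2)
    by (subst l_0_eq; simp add: power_divide add_divide_distrib diff_divide_distrib)
  then show ?thesis
    by (rule mult_left_less_imp_less) simp
qed

text \<open>
  The sum in \<open>l 0\<close> is empty, and \<open>Digamma 1 = - \<gamma>\<close>.
\<close>

lemma is_root_iff: "is_root a \<longleftrightarrow> a > 1 / 15 \<and> l 0 a = euler_mascheroni"
  by (auto simp: is_root_def l_def harm_def)

lemma root_exists: "\<exists>a\<in>{0.5129670714015..0.5129670714025}. is_root a"
proof -
  have "\<exists>a\<ge>0.5129670714015. a \<le> 0.5129670714025 \<and> l 0 a = euler_mascheroni"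
    using l_0_upper_end l_0_lower_end
    by (intro IVT2' continuous_on_subset[OF l_continuous]) auto
  then show ?thesis by (fastforce simp: is_root_iff)
qed

lemma root_unique:
  assumes "is_root a" "is_root b"
  shows "a = b"
proof (rule linorder_cases[of a b])
  assume "a < b"
  then have "l 0 b < l 0 a"
    using assms by (intro monotone_onD[OF l_strict_antimono]) (auto simp: is_root_iff)
  then show ?thesis using assms by (simp add: is_root_iff)
next
  assume "b < a"
  then have "l 0 a < l 0 b"
    using assms by (intro monotone_onD[OF l_strict_antimono]) (auto simp: is_root_iff)
  then show ?thesis using assms by (simp add: is_root_iff)
qed

lemma a\<^sub>0_bounds: "a\<^sub>0 \<in> {0.5129670714015..0.5129670714025}"
proof -
  obtain a where a: "a \<in> {0.5129670714015..0.5129670714025}" "is_root a"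
    using root_exists by blast
  then have "a\<^sub>0 = a"
    unfolding a\<^sub>0_def by (intro the_equality) (auto intro: root_unique)
  with a show ?thesis by simp
qed

section \<open>The sharp bounds\<close>

text \<open>
  The parameter \<open>8/15\<close> lies above \<open>a\<^sub>0\<close> and still satisfies \<open>u\<^sup>2 v\<^sup>2 < 4 c\<close>, so
  the comparison with \<open>\<gamma>\<close> holds for it from \<open>n = 1\<close> on; monotonicity transfers it to \<open>a\<^sub>0\<close>.
\<close>

lemma euler_mascheroni_less_l_a\<^sub>0:
  assumes "n \<ge> 1"
  shows "euler_mascheroni < l n a\<^sub>0"
proof -
  have "(2::real)\<^sup>2 \<le> (real n + 1)\<^sup>2"
    using assms by (intro power_mono) auto
  then have "euler_mascheroni < l n (8 / 15)"
    by (intro euler_mascheroni_less_l)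
       (simp_all add: leading_coeff_def upper_shift_def lower_shift_def power_divide)
  also have "l n (8 / 15) < l n a\<^sub>0"
    using a\<^sub>0_bounds by (intro monotone_onD[OF l_strict_antimono]) auto
  finally show ?thesis .
qed

lemma eventually_euler_mascheroni_less_l:
  assumes "1 / 15 < a" and "a < a\<^sub>1"
  shows "\<forall>\<^sub>F n in sequentially. euler_mascheroni < l n a"
proof -
  have pos: "leading_coeff a > 0"
    using leading_coeff_strict_antimono[of a a\<^sub>1] assms by (simp add: leading_coeff_a\<^sub>1)
  have "filterlim (\<lambda>n. (real n + 1)\<^sup>2) at_top sequentially"
    by real_asymp
  then have "\<forall>\<^sub>F n in sequentially. (upper_shift a)\<^sup>2 * (lower_shift a)\<^sup>2 / leading_coeff a < (real n + 1)\<^sup>2"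
    by (simp add: filterlim_at_top_dense)
  then show ?thesis
    by eventually_elim (use assms pos in \<open>auto intro!: euler_mascheroni_less_l simp: field_simps\<close>)
qed

theorem theorem6:
  shows "(\<exists>!a. is_root a)
    \<and> \<bar>a\<^sub>0 - 0.512967071402\<bar> \<le> 5 / 10 ^ 13
    \<and> (\<forall>n\<ge>1. l n a\<^sub>1 < euler_mascheroni \<and> euler_mascheroni \<le> l n a\<^sub>0)
    \<and> (\<forall>a\<in>{1/15<..<a\<^sub>1}. \<not> (\<forall>n\<ge>1. l n a < euler_mascheroni))
    \<and> (\<forall>n\<ge>1. strict_antimono_on {1/15<..} (l n))"
proof (intro conjI ballI allI impI)
  show "\<exists>!a. is_root a"
    using root_exists root_unique by blast
  show "\<bar>a\<^sub>0 - 0.512967071402\<bar> \<le> 5 / 10 ^ 13"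
    using a\<^sub>0_bounds by (intro abs_leI) auto
  fix n :: nat assume "n \<ge> 1"
  show "l n a\<^sub>1 < euler_mascheroni"
    using l_less_euler_mascheroni[OF a\<^sub>1_gt] by (simp add: leading_coeff_a\<^sub>1)
  show "euler_mascheroni \<le> l n a\<^sub>0"
    using euler_mascheroni_less_l_a\<^sub>0[OF \<open>n \<ge> 1\<close>] by simp
next
  fix a assume "a \<in> {1/15<..<a\<^sub>1}"
  then have "\<forall>\<^sub>F n in sequentially. euler_mascheroni < l n a"
    by (intro eventually_euler_mascheroni_less_l) auto
  then obtain N where N: "\<And>n. n \<ge> N \<Longrightarrow> euler_mascheroni < l n a"
    by (auto simp: eventually_sequentially)
  show "\<not> (\<forall>n\<ge>1. l n a < euler_mascheroni)"
    using N[of "max N 1"] by (meson less_asym max.cobounded1 max.cobounded2)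
qed (rule l_strict_antimono)

end
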